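(* For every $n\in\mathbb{N}$, there exists a set of $n$ points from $\mathbb{R}\mathcal{P}^2$ in general position with no projective $8$-hole.
   Context: A finite set of points in the real projective plane $\mathbb{R}\mathcal{P}^2$ is in general position if no three of its points lie on a common projective line. A Euclidean plane $\rho\subset\mathbb{R}\mathcal{P}^2$ is the set obtained by removing a projective line. A subset $X\subset\mathbb{R}\mathcal{P}^2$ is semiconvex if any two points of $X$ can be joined by a (projective) line segment contained in $X$; it is convex if it is semiconvex and contained in some Euclidean plane $\rho\subset\mathbb{R}\mathcal{P}^2$. A projective convex hull of $Y\subset\mathbb{R}\mathcal{P}^2$ is an inclusion-wise minimal convex subset of $\mathbb{R}\mathcal{P}^2$ containing $Y$ (it need not be unique). For a finite set $P\subset\mathbb{R}\mathcal{P}^2$ in general position, a projective $k$-gon determined by $P$ is a projective convex hull of a set $G$ of $k$ points of $P$ which contains all points of $G$ on its boundary; equivalently, it is a subset of $\mathbb{R}\mathcal{P}^2$ that is a convex polygon with $k$ vertices, all in $P$, in some Euclidean plane $\rho\subset\mathbb{R}\mathcal{P}^2$. A projective $k$-hole in $P$ ($k\ge3$) is a projective $k$-gon determined by $P$ that contains no point of $P$ in its interior. *)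

theory Defs
  imports "HOL-Analysis.Analysis"
begin

text \<open>The real projective plane, given by homogeneous coordinates: nonzero vectors of
  \<open>\<real>\<^sup>3\<close> up to nonzero scalar multiples.\<close>

definition proj_rel :: "real ^ 3 \<Rightarrow> real ^ 3 \<Rightarrow> bool" where
  "proj_rel u v \<longleftrightarrow> u \<noteq> 0 \<and> v \<noteq> 0 \<and> (\<exists>c. c \<noteq> 0 \<and> v = c *\<^sub>R u)"

lemma part_equivp_proj_rel: "part_equivp proj_rel"
proof (rule part_equivpI)
  show "\<exists>u. proj_rel u u"
    by (rule exI[of _ "axis 1 1"]) (auto simp: proj_rel_def axis_eq_0_iff intro: exI[of _ 1])
  show "symp proj_rel"
  proof (rule sympI)
    fix u v assume "proj_rel u v"
    then obtain c where "u \<noteq> 0" "v \<noteq> 0" "c \<noteq> 0" "v = c *\<^sub>R u"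
      by (auto simp: proj_rel_def)
    then show "proj_rel v u"
      unfolding proj_rel_def by (intro conjI exI[of _ "inverse c"]) auto
  qed
  show "transp proj_rel"
  proof (rule transpI)
    fix u v w assume "proj_rel u v" "proj_rel v w"
    then obtain c d where "u \<noteq> 0" "w \<noteq> 0" "c \<noteq> 0" "v = c *\<^sub>R u" "d \<noteq> 0" "w = d *\<^sub>R v"
      by (auto simp: proj_rel_def)
    then show "proj_rel u w"
      unfolding proj_rel_def by (intro conjI exI[of _ "d * c"]) auto
  qed
qed

quotient_type rp2 = "real ^ 3" / partial: proj_rel
  by (rule part_equivp_proj_rel)

text \<open>The point with homogeneous coordinates \<open>v\<close>; meaningful for \<open>v \<noteq> 0\<close> only.\<close>

definition proj :: "real ^ 3 \<Rightarrow> rp2" where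
  "proj = abs_rp2"

lemma proj_eq_iff:
  assumes "u \<noteq> 0" "v \<noteq> 0"
  shows "proj u = proj v \<longleftrightarrow> (\<exists>c. c \<noteq> 0 \<and> v = c *\<^sub>R u)"
proof -
  have refl: "proj_rel w w" if "w \<noteq> 0" for w
    using that by (auto simp: proj_rel_def intro: exI[of _ 1])
  have "proj u = proj v \<longleftrightarrow> proj_rel u v"
    using Quotient3_rel[OF Quotient3_rp2, of u v] refl assms by (auto simp: proj_def)
  then show ?thesis
    using assms by (simp add: proj_rel_def)
qed

lemma proj_surj: "\<exists>v. v \<noteq> 0 \<and> p = proj v"
proof -
  have "proj_rel (rep_rp2 p) (rep_rp2 p)" "p = abs_rp2 (rep_rp2 p)"
    using Quotient3_rep_reflp[OF Quotient3_rp2] Quotient3_abs_rep[OF Quotient3_rp2] by auto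
  then show ?thesis
    by (metis proj_def proj_rel_def)
qed

text \<open>The quotient topology. The preimage is taken in \<open>\<real>\<^sup>3 - {0}\<close>, which is itself open
  in \<open>\<real>\<^sup>3\<close>.\<close>

instantiation rp2 :: topological_space
begin

definition open_rp2 :: "rp2 set \<Rightarrow> bool" where
  "open_rp2 U \<longleftrightarrow> open {v. v \<noteq> 0 \<and> proj v \<in> U}"

instance
proof
  have "{v :: real ^ 3. v \<noteq> 0 \<and> proj v \<in> UNIV} = - {0}"
    by auto
  then show "open (UNIV :: rp2 set)"
    by (simp add: open_rp2_def open_Compl)
next
  fix S T :: "rp2 set"
  assume "open S" "open T"
  moreover have "{v. v \<noteq> 0 \<and> proj v \<in> S \<inter> T} =
      {v. v \<noteq> 0 \<and> proj v \<in> S} \<inter> {v. v \<noteq> 0 \<and> proj v \<in> T}"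
    by auto
  ultimately show "open (S \<inter> T)"
    by (simp only: open_rp2_def open_Int)
next
  fix K :: "rp2 set set"
  assume "\<forall>S\<in>K. open S"
  moreover have "{v. v \<noteq> 0 \<and> proj v \<in> \<Union>K} = (\<Union>S\<in>K. {v. v \<noteq> 0 \<and> proj v \<in> S})"
    by auto
  ultimately show "open (\<Union>K)"
    by (simp only: open_rp2_def) (blast intro: open_UN)
qed

end

definition proj_line :: "rp2 set \<Rightarrow> bool" where
  "proj_line L \<longleftrightarrow> (\<exists>a :: real ^ 3. a \<noteq> 0 \<and> L = {proj v | v. v \<noteq> 0 \<and> a \<bullet> v = 0})"

definition general_position :: "rp2 set \<Rightarrow> bool" where
  "general_position P \<longleftrightarrow> \<not> (\<exists>T L. T \<subseteq> P \<and> card T = 3 \<and> proj_line L \<and> T \<subseteq> L)"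

definition euclidean_plane :: "rp2 set \<Rightarrow> bool" where
  "euclidean_plane R \<longleftrightarrow> (\<exists>L. proj_line L \<and> R = - L)"

text \<open>Two distinct points \<open>proj u\<close> and \<open>proj v\<close> are joined by exactly two segments, the images of
  the vector segments from \<open>u\<close> to \<open>v\<close> and from \<open>u\<close> to \<open>- v\<close>; neither vector segment
  contains \<open>0\<close>. If the two points coincide, then the only segment is the singleton.\<close>

definition proj_segment :: "rp2 \<Rightarrow> rp2 \<Rightarrow> rp2 set \<Rightarrow> bool" where
  "proj_segment p q S \<longleftrightarrow>
     (\<exists>u v. u \<noteq> 0 \<and> v \<noteq> 0 \<and> p = proj u \<and> q = proj v \<and> S = proj ` (closed_segment u v - {0}))"

definition semiconvex :: "rp2 set \<Rightarrow> bool" where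
  "semiconvex X \<longleftrightarrow> (\<forall>p\<in>X. \<forall>q\<in>X. \<exists>S. proj_segment p q S \<and> S \<subseteq> X)"

definition proj_convex :: "rp2 set \<Rightarrow> bool" where
  "proj_convex X \<longleftrightarrow> semiconvex X \<and> (\<exists>R. euclidean_plane R \<and> X \<subseteq> R)"

definition proj_convex_hull :: "rp2 set \<Rightarrow> rp2 set \<Rightarrow> bool" where
  "proj_convex_hull Y X \<longleftrightarrow> proj_convex X \<and> Y \<subseteq> X \<and>
     (\<forall>Z. proj_convex Z \<and> Y \<subseteq> Z \<and> Z \<subseteq> X \<longrightarrow> Z = X)"

definition proj_gon :: "nat \<Rightarrow> rp2 set \<Rightarrow> rp2 set \<Rightarrow> bool" where
  "proj_gon k P X \<longleftrightarrow>
     (\<exists>G. G \<subseteq> P \<and> finite G \<and> card G = k \<and> proj_convex_hull G X \<and> G \<subseteq> frontier X)"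

definition proj_hole :: "nat \<Rightarrow> rp2 set \<Rightarrow> rp2 set \<Rightarrow> bool" where
  "proj_hole k P X \<longleftrightarrow> 3 \<le> k \<and> proj_gon k P X \<and> P \<inter> interior X = {}"

end

theory Submission
  imports Defs
begin

text \<open>A Horton set has no projective 8-hole. Represent the points \<open>(i, y i)\<close> by the vectors
  \<open>v\<^sub>i = (1, i, y i)\<close>. A convex set \<open>X\<close> avoids some line \<open>a \<bullet> v = 0\<close>, so each point of \<open>X\<close> gets the
  sign of \<open>s i = a \<bullet> v\<^sub>i\<close>, and the vectors \<open>s i v\<^sub>i\<close> of three points of \<open>X\<close> span an open cone whose
  projective image lies in the interior of \<open>X\<close> (\<open>triangle_in_interior\<close>). In a hole no such cone
  may contain \<open>v\<^sub>k\<close> or \<open>- v\<^sub>k\<close> for a point \<open>k\<close> of the set. This condition on signs and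
  orientations, called \<open>empty_triangles\<close>, is all that is used of a hole, and it already
  bounds the number of vertices by 7 (\<open>horton_empty_triangles_le_7\<close>).

  A Horton set splits into two interleaved Horton sets \<open>A\<close> and \<open>B\<close>, where \<open>A\<close> lies so far below
  \<open>B\<close> that seen from the other half each of them looks like a set on a horizontal line. These
  two lines meet in the point at infinity \<open>q\<close>. Descending to the first level where the vertex
  set \<open>G\<close> meets both halves, two facts suffice.

  The vertices in one half that have the same sign form a convex chain, and the triangles
  with a vertex in the other half force the region on one side of that chain to contain no
  point of that half. The classical argument of Horton shows that such a chain has
  at most 3 points (\<open>horton_empty_cup_le_3\<close>).

  If the vertices in \<open>A\<close> have both signs, then the side of \<open>X\<close> along \<open>A\<close> passes through \<open>q\<close>. The
  line of \<open>B\<close> crosses that side at \<open>q\<close>, so on each of the two rays into \<open>q\<close> only the first point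
  of \<open>X\<close> can be a vertex: there is at most one vertex of each sign in \<open>B\<close>
  (\<open>positive_class_le_1_if_mixed\<close>), and the same holds with \<open>A\<close> and \<open>B\<close> exchanged.

  Hence if neither half has both signs, there are at most 3 + 3 vertices; if exactly one does,
  at most (3 + 3) + 1; if both do, at most 2 + 2.\<close>

section \<open>Orientations and Horton sets\<close>

text \<open>The determinant of \<open>v\<^sub>i, v\<^sub>j, v\<^sub>k\<close>: for \<open>i < j\<close> it is positive exactly if the point \<open>(k, y k)\<close>
  lies above the line through the points of \<open>i\<close> and \<open>j\<close>.\<close>

definition orient :: "(nat \<Rightarrow> real) \<Rightarrow> nat \<Rightarrow> nat \<Rightarrow> nat \<Rightarrow> real" where
  "orient y i j k = (real j - real i) * (y k - y i) - (real k - real i) * (y j - y i)"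

lemma orient_rotate: "orient y j k i = orient y i j k"
  by (simp add: orient_def algebra_simps)

lemma orient_swap: "orient y i k j = - orient y i j k"
  by (simp add: orient_def algebra_simps)

lemma orient_uminus: "orient (\<lambda>i. - y i) i j k = - orient y i j k"
  by (simp add: orient_def algebra_simps)

definition deep_below :: "(nat \<Rightarrow> real) \<Rightarrow> nat set \<Rightarrow> nat set \<Rightarrow> bool" where
  "deep_below y A B \<longleftrightarrow>
     (\<forall>i\<in>A. \<forall>j\<in>A. \<forall>k\<in>B. i < j \<longrightarrow> orient y i j k > 0) \<and>
     (\<forall>i\<in>B. \<forall>j\<in>B. \<forall>k\<in>A. i < j \<longrightarrow> orient y i j k < 0)"

definition separates :: "nat set \<Rightarrow> nat set \<Rightarrow> bool" where
  "separates B A \<longleftrightarrow> (\<forall>i\<in>A. \<forall>j\<in>A. i < j \<longrightarrow> (\<exists>k\<in>B. i < k \<and> k < j))"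

text \<open>Since the two halves only have to separate each other, reflection in a horizontal line,
  which exchanges their roles, preserves the notion. This halves the case analyses below.\<close>

inductive horton :: "(nat \<Rightarrow> real) \<Rightarrow> nat set \<Rightarrow> bool" for y where
  empty: "horton y {}"
| singleton: "horton y {i}"
| split: "horton y A \<Longrightarrow> horton y B \<Longrightarrow> deep_below y A B \<Longrightarrow>
    separates A B \<Longrightarrow> separates B A \<Longrightarrow> horton y (A \<union> B)"

lemma deep_below_uminus: "deep_below y A B \<Longrightarrow> deep_below (\<lambda>i. - y i) B A"
  unfolding deep_below_def orient_uminus by auto

lemma horton_uminus: "horton y S \<Longrightarrow> horton (\<lambda>i. - y i) S"
proof (induction rule: horton.induct)
  case (split A B)
  then have "horton (\<lambda>i. - y i) (B \<union> A)"
    by (intro horton.split deep_below_uminus) auto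
  then show ?case
    by (simp add: Un_commute)
qed (auto intro: horton.intros)

lemma horton_orient_nonzero:
  assumes "horton y S" "i \<in> S" "j \<in> S" "k \<in> S" "i < j" "j < k"
  shows "orient y i j k \<noteq> 0"
  using assms
proof (induction arbitrary: i j k rule: horton.induct)
  case (split A B)
  have "i < k"
    using split.prems by simp
  have AAB: "orient y p q r \<noteq> 0" if "p \<in> A" "q \<in> A" "r \<in> B" "p < q" for p q r
    using split.hyps(3) that unfolding deep_below_def by force
  have BBA: "orient y p q r \<noteq> 0" if "p \<in> B" "q \<in> B" "r \<in> A" "p < q" for p q r
    using split.hyps(3) that unfolding deep_below_def by force
  have "orient y i k j = - orient y i j k" "orient y j k i = orient y i j k"
    by (rule orient_swap, rule orient_rotate)
  then show ?case
    using split.prems split.IH \<open>i < k\<close> AAB[of i j k] AAB[of i k j] AAB[of j k i]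
      BBA[of i j k] BBA[of i k j] BBA[of j k i]
    by (metis UnE neg_equal_0_iff_equal)
qed auto

lemma card_le_1I:
  fixes H :: "nat set"
  assumes "\<And>i j. i \<in> H \<Longrightarrow> j \<in> H \<Longrightarrow> i < j \<Longrightarrow> False"
  shows "card H \<le> 1"
proof (cases "finite H")
  case True
  then show ?thesis
    using assms by (metis card_le_Suc0_iff_eq linorder_neqE_nat One_nat_def)
qed simp

section \<open>Empty cups\<close>

text \<open>Horton's argument. Let the cup meet both halves. Two of its points in \<open>A\<close> have a point of \<open>B\<close>
  between them, which lies above their chord; so the cup has a single point \<open>e\<close> in \<open>A\<close>. Two of its
  points in \<open>B\<close> on the same side of \<open>e\<close> would span a line above \<open>e\<close>, which puts the middle one of
  the three points above the chord of the other two. This leaves \<open>e\<close> and one point on each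
  side. The last hypothesis with \<open>k \<in> H\<close> says that \<open>H\<close> is a cup, and with the other \<open>k\<close> that
  no further point lies above one of its chords.\<close>

lemma horton_empty_cup_le_3:
  assumes "horton y S" "H \<subseteq> S" "finite H"
    and "\<And>i j k. i \<in> H \<Longrightarrow> j \<in> H \<Longrightarrow> k \<in> S \<Longrightarrow> i < k \<Longrightarrow> k < j \<Longrightarrow> \<not> orient y i j k > 0"
  shows "card H \<le> 3"
  using assms
proof (induction arbitrary: H rule: horton.induct)
  case empty
  then show ?case by simp
next
  case (singleton i)
  then have "card H \<le> card {i}"
    by (intro card_mono) auto
  then show ?case by simp
next
  case (split A B)
  note cup = split.prems(3)
  have above: "orient y i j k > 0" if "i \<in> A" "j \<in> A" "k \<in> B" "i < j" for i j k
    using split.hyps(3) that unfolding deep_below_def by blast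
  have below: "orient y i j k < 0" if "i \<in> B" "j \<in> B" "k \<in> A" "i < j" for i j k
    using split.hyps(3) that unfolding deep_below_def by blast
  consider "H \<subseteq> A" | "H \<subseteq> B" | e where "e \<in> H" "e \<in> A" "\<not> H \<subseteq> A"
    using split.prems(1) by blast
  then show ?case
  proof cases
    case 1
    then show ?thesis
      using split.IH(1)[OF 1 split.prems(2)] cup by blast
  next
    case 2
    then show ?thesis
      using split.IH(2)[OF 2 split.prems(2)] cup by blast
  next
    case 3
    have A1: "card (H \<inter> A) \<le> 1"
    proof (rule card_le_1I)
      fix i j
      assume ij: "i \<in> H \<inter> A" "j \<in> H \<inter> A" "i < j"
      then obtain k where "k \<in> B" "i < k" "k < j"
        using split.hyps(5) unfolding separates_def by blast
      then show False
        using cup[of i j k] above[of i j k] ij by auto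
    qed
    have right: "card {i \<in> H \<inter> B. e < i} \<le> 1"
    proof (rule card_le_1I)
      fix i j
      assume ij: "i \<in> {i \<in> H \<inter> B. e < i}" "j \<in> {i \<in> H \<inter> B. e < i}" "i < j"
      have "orient y e j i = - orient y i j e"
        using orient_rotate[of y i j e] orient_swap[of y e i j] by simp
      then show False
        using cup[of e j i] below[of i j e] ij 3 by auto
    qed
    have left: "card {i \<in> H \<inter> B. i < e} \<le> 1"
    proof (rule card_le_1I)
      fix i j
      assume ij: "i \<in> {i \<in> H \<inter> B. i < e}" "j \<in> {i \<in> H \<inter> B. i < e}" "i < j"
      have "orient y i e j = - orient y i j e"
        by (rule orient_swap)
      then show False
        using cup[of i e j] below[of i j e] ij 3 by auto
    qed
    have "H \<subseteq> (H \<inter> A) \<union> ({i \<in> H \<inter> B. e < i} \<union> {i \<in> H \<inter> B. i < e})"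
      using split.prems(1) 3(2) by (auto simp: not_less_iff_gr_or_eq)
    then have "card H \<le> card ((H \<inter> A) \<union> ({i \<in> H \<inter> B. e < i} \<union> {i \<in> H \<inter> B. i < e}))"
      using split.prems(2) by (intro card_mono) auto
    also have "\<dots> \<le> card (H \<inter> A) + (card {i \<in> H \<inter> B. e < i} + card {i \<in> H \<inter> B. i < e})"
      by (meson add_left_mono card_Un_le le_trans)
    finally show ?thesis
      using A1 left right by simp
  qed
qed

section \<open>Signed vertices with empty triangles\<close>

text \<open>By Cramer's rule, the coefficient of \<open>v\<^sub>k\<close> at \<open>s i v\<^sub>i\<close> has, up to a sign common to all three
  coefficients, the sign of \<open>s i * orient y k j l\<close>, and similarly for \<open>j\<close> and \<open>l\<close>. So for independent
  \<open>v\<^sub>i, v\<^sub>j, v\<^sub>l\<close> this says that \<open>v\<^sub>k\<close> or \<open>- v\<^sub>k\<close> is in the open cone spanned by \<open>s i v\<^sub>i, s j v\<^sub>j, s l v\<^sub>l\<close>.\<close>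

definition in_cone :: "(nat \<Rightarrow> real) \<Rightarrow> (nat \<Rightarrow> real) \<Rightarrow> nat \<Rightarrow> nat \<Rightarrow> nat \<Rightarrow> nat \<Rightarrow> bool" where
  "in_cone y s i j l k \<longleftrightarrow>
     (0 < s i * orient y k j l \<and> 0 < s j * orient y i k l \<and> 0 < s l * orient y i j k) \<or>
     (s i * orient y k j l < 0 \<and> s j * orient y i k l < 0 \<and> s l * orient y i j k < 0)"

lemma in_cone_uminus: "in_cone (\<lambda>i. - y i) s i j l k = in_cone y s i j l k"
  unfolding in_cone_def orient_uminus by auto

lemma in_cone_uminus_sign: "in_cone y (\<lambda>i. - s i) i j l k = in_cone y s i j l k"
  unfolding in_cone_def by auto

definition empty_triangles :: "(nat \<Rightarrow> real) \<Rightarrow> (nat \<Rightarrow> real) \<Rightarrow> nat set \<Rightarrow> nat set \<Rightarrow> bool" where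
  "empty_triangles y s S G \<longleftrightarrow> (\<forall>i\<in>G. \<forall>j\<in>G. \<forall>l\<in>G. \<forall>k\<in>S. \<not> in_cone y s i j l k)"

lemma empty_triangles_uminus:
  "empty_triangles (\<lambda>i. - y i) s S G = empty_triangles y s S G"
  unfolding empty_triangles_def in_cone_uminus ..

lemma empty_triangles_uminus_sign:
  "empty_triangles y (\<lambda>i. - s i) S G = empty_triangles y s S G"
  unfolding empty_triangles_def in_cone_uminus_sign ..

text \<open>A vertex \<open>g\<close> in \<open>B\<close> turns the triangles \<open>i, j, g\<close> with \<open>i < j\<close> in \<open>A\<close> into vertical strips over
  or under the chord from \<open>i\<close> to \<open>j\<close>, as far as points of \<open>A\<close> are concerned. They are above the
  chord if \<open>g\<close> is positive. If \<open>g\<close> is negative, the triangle reaches \<open>g\<close> through infinity, so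
  they are below it, and the reflected set has an empty cup.\<close>

lemma positive_class_le_3:
  assumes "horton y A" "deep_below y A B" "finite G"
    and empty: "empty_triangles y s (A \<union> B) G"
    and g: "g \<in> G \<inter> B" "s g \<noteq> 0"
  shows "card {i \<in> G \<inter> A. 0 < s i} \<le> 3"
proof -
  let ?H = "{i \<in> G \<inter> A. 0 < s i}"
  have no: "\<not> s g * orient y i j k > 0" if "i \<in> ?H" "j \<in> ?H" "k \<in> A" "i < k" "k < j" for i j k
  proof -
    have "orient y i k g > 0" "orient y k j g > 0"
      using assms(2) g that unfolding deep_below_def by auto
    moreover have "\<not> in_cone y s i j g k"
      using empty g that unfolding empty_triangles_def by auto
    ultimately show ?thesis
      using that unfolding in_cone_def by auto
  qed
  consider "s g > 0" | "s g < 0"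
    using g(2) by linarith
  then show ?thesis
  proof cases
    case 1
    then show ?thesis
      using no assms(3)
      by (intro horton_empty_cup_le_3[OF assms(1)]) (auto simp: zero_less_mult_iff)
  next
    case 2
    then show ?thesis
      using no assms(3)
      by (intro horton_empty_cup_le_3[OF horton_uminus[OF assms(1)]])
        (auto simp: zero_less_mult_iff orient_uminus)
  qed
qed

text \<open>The side from \<open>p\<close> to \<open>- q\<close> runs through the point at infinity of the two lines. Of two positive
  vertices \<open>g < k\<close> in \<open>B\<close>, one is then in the triangle spanned by \<open>p\<close>, \<open>q\<close> and the other one.
  For \<open>q < p\<close> the side leaves \<open>p\<close> to the right, and the inner point is \<open>k\<close>; for \<open>p < q\<close> it
  leaves \<open>p\<close> to the left, and the inner point is \<open>g\<close>.\<close>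

lemma positive_class_le_1_if_mixed:
  assumes "deep_below y A B"
    and empty: "empty_triangles y s (A \<union> B) G"
    and "p \<in> G \<inter> A" "0 < s p" "q \<in> G \<inter> A" "s q < 0"
  shows "card {i \<in> G \<inter> B. 0 < s i} \<le> 1"
proof (rule card_le_1I)
  fix g k
  assume gk: "g \<in> {i \<in> G \<inter> B. 0 < s i}" "k \<in> {i \<in> G \<inter> B. 0 < s i}" "g < k"
  have q: "orient y g k q < 0" and p: "orient y g k p < 0"
    using assms gk unfolding deep_below_def by auto
  have "p \<noteq> q"
    using assms by auto
  then consider "p < q" | "q < p"
    by linarith
  then show False
  proof cases
    case 1
    then have "orient y p q g > 0"
      using assms gk unfolding deep_below_def by auto
    moreover have "orient y g q k = - orient y g k q" "orient y p g k = orient y g k p"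
      by (rule orient_swap, rule orient_rotate[symmetric])
    ultimately have "in_cone y s p q k g"
      using p q gk assms unfolding in_cone_def by (intro disjI1) (auto simp: mult_neg_neg mult_pos_neg mult_neg_pos)
    then show False
      using empty assms gk unfolding empty_triangles_def by auto
  next
    case 2
    then have "orient y q p k > 0"
      using assms gk unfolding deep_below_def by auto
    moreover have "orient y p q k = - orient y q p k"
      using orient_rotate[of y q k p] orient_swap[of y q k p] by simp
    moreover have "orient y k q g = orient y g k q"
      by (rule orient_rotate)
    moreover have "orient y p k g = - orient y g k p"
      using orient_rotate[of y p k g] orient_swap[of y g p k] by simp
    ultimately have "in_cone y s p q g k"
      using p q gk assms unfolding in_cone_def
      by (intro disjI2) (auto simp: mult_neg_pos mult_pos_neg mult_neg_neg)
    then show False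
      using empty assms gk unfolding empty_triangles_def by auto
  qed
qed

lemma card_sign_classes:
  fixes s :: "nat \<Rightarrow> real"
  assumes "finite G" "\<And>i. i \<in> G \<Longrightarrow> s i \<noteq> 0"
  shows "card G = card {i \<in> G. 0 < s i} + card {i \<in> G. s i < 0}"
proof -
  have "G = {i \<in> G. 0 < s i} \<union> {i \<in> G. s i < 0}"
    using assms(2) by force
  moreover have "card ({i \<in> G. 0 < s i} \<union> {i \<in> G. s i < 0}) =
      card {i \<in> G. 0 < s i} + card {i \<in> G. s i < 0}"
    using assms(1) by (intro card_Un_disjoint) auto
  ultimately show ?thesis
    by simp
qed

text \<open>Negating \<open>s\<close> exchanges positive and negative vertices, and negating \<open>y\<close> exchanges the two
  halves. So the two preceding bounds hold for all four classes of vertices.\<close>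

lemma horton_empty_triangles_le_7:
  assumes "horton y S" "G \<subseteq> S" "finite G"
    and "\<And>i. i \<in> G \<Longrightarrow> s i \<noteq> 0" "empty_triangles y s S G"
  shows "card G \<le> 7"
  using assms
proof (induction arbitrary: G rule: horton.induct)
  case empty
  then show ?case by simp
next
  case (singleton i)
  then have "card G \<le> card {i}"
    by (intro card_mono) auto
  then show ?case by simp
next
  case (split A B)
  note nz = split.prems(3) and et = split.prems(4)
  have mono: "empty_triangles y s A G" "empty_triangles y s B G"
    using et unfolding empty_triangles_def by blast+
  consider "G \<subseteq> A" | "G \<subseteq> B" | f g where "f \<in> G \<inter> A" "g \<in> G \<inter> B"
    using split.prems(1) by blast
  then show ?case
  proof cases
    case 1
    then show ?thesis
      using split.IH(1) split.prems mono by blast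
  next
    case 2
    then show ?thesis
      using split.IH(2) split.prems mono by blast
  next
    case 3
    let ?y = "\<lambda>i. - y i" and ?s = "\<lambda>i. - s i"
    let ?Ap = "{i \<in> G \<inter> A. 0 < s i}" and ?An = "{i \<in> G \<inter> A. s i < 0}"
    let ?Bp = "{i \<in> G \<inter> B. 0 < s i}" and ?Bn = "{i \<in> G \<inter> B. s i < 0}"
    have dB: "deep_below ?y B A"
      by (rule deep_below_uminus[OF split.hyps(3)])
    have hB: "horton ?y B"
      by (rule horton_uminus[OF split.hyps(2)])
    have et': "empty_triangles y ?s (A \<union> B) G" "empty_triangles ?y s (B \<union> A) G"
        "empty_triangles ?y ?s (B \<union> A) G"
      using et by (simp_all add: empty_triangles_uminus empty_triangles_uminus_sign Un_commute)
    have le3: "card ?Ap \<le> 3" "card ?An \<le> 3" "card ?Bp \<le> 3" "card ?Bn \<le> 3"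
      using positive_class_le_3[OF split.hyps(1) split.hyps(3) split.prems(2) et 3(2)]
        positive_class_le_3[OF split.hyps(1) split.hyps(3) split.prems(2) et'(1) 3(2)]
        positive_class_le_3[OF hB dB split.prems(2) et'(2) 3(1)]
        positive_class_le_3[OF hB dB split.prems(2) et'(3) 3(1)] nz 3
      by auto
    have mixedA: "card ?Bp \<le> 1 \<and> card ?Bn \<le> 1" if "?Ap \<noteq> {}" "?An \<noteq> {}"
    proof -
      obtain p q where "p \<in> ?Ap" "q \<in> ?An"
        using \<open>?Ap \<noteq> {}\<close> \<open>?An \<noteq> {}\<close> by blast
      then show ?thesis
        using positive_class_le_1_if_mixed[OF split.hyps(3) et, of p q]
          positive_class_le_1_if_mixed[OF split.hyps(3) et'(1), of q p] by auto
    qed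
    have mixedB: "card ?Ap \<le> 1 \<and> card ?An \<le> 1" if "?Bp \<noteq> {}" "?Bn \<noteq> {}"
    proof -
      obtain p q where "p \<in> ?Bp" "q \<in> ?Bn"
        using \<open>?Bp \<noteq> {}\<close> \<open>?Bn \<noteq> {}\<close> by blast
      then show ?thesis
        using positive_class_le_1_if_mixed[OF dB et'(2), of p q]
          positive_class_le_1_if_mixed[OF dB et'(3), of q p] by auto
    qed
    have zero: "card H = 0" if "H = {}" for H :: "nat set"
      using that by simp
    have "G = (G \<inter> A) \<union> (G \<inter> B)"
      using split.prems(1) by blast
    then have "card G \<le> card (G \<inter> A) + card (G \<inter> B)"
      by (metis card_Un_le)
    also have "card (G \<inter> A) = card ?Ap + card ?An"
      using card_sign_classes[of "G \<inter> A" s] split.prems(2) nz by auto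
    also have "card (G \<inter> B) = card ?Bp + card ?Bn"
      using card_sign_classes[of "G \<inter> B" s] split.prems(2) nz by auto
    finally show ?thesis
      using le3 mixedA mixedB zero[of ?Ap] zero[of ?An] zero[of ?Bp] zero[of ?Bn] by linarith
  qed
qed

section \<open>Existence of Horton sets\<close>

lemma horton_dilate:
  assumes "horton y S" "0 < e" "\<And>i. i \<in> S \<Longrightarrow> z (2 * i + r) = c + e * y i"
  shows "horton z ((\<lambda>i. 2 * i + r) ` S)"
  using assms(1,3)
proof (induction rule: horton.induct)
  case (split A B)
  have eq: "orient z (2 * i + r) (2 * j + r) (2 * k + r) = (2 * e) * orient y i j k"
    if "i \<in> A \<union> B" "j \<in> A \<union> B" "k \<in> A \<union> B" for i j k
    using that split.prems by (simp add: orient_def algebra_simps)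
  have "deep_below z ((\<lambda>i. 2 * i + r) ` A) ((\<lambda>i. 2 * i + r) ` B)"
    using split.hyps(3) assms(2) unfolding deep_below_def
    by (auto simp: eq mult_pos_neg)
  moreover have "separates ((\<lambda>i. 2 * i + r) ` A) ((\<lambda>i. 2 * i + r) ` B)"
      "separates ((\<lambda>i. 2 * i + r) ` B) ((\<lambda>i. 2 * i + r) ` A)"
    using split.hyps(4,5) unfolding separates_def by auto
  ultimately show ?case
    unfolding image_Un using split.IH split.prems by (intro horton.split) auto
qed (auto intro: horton.intros)

text \<open>Put a flattened copy of a smaller Horton set on the even abscissae near height 0, and another
  one on the odd abscissae near height 1. In the limit \<open>e = 0\<close> both copies are horizontal and the
  finitely many strict inequalities of \<open>deep_below\<close> hold, so they hold for all small \<open>e > 0\<close>.\<close>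

lemma horton_exists: "\<exists>y. horton y {..<n}"
proof (induction n rule: less_induct)
  case (less n)
  consider "n = 0" | "n = 1" | "n \<ge> 2"
    by linarith
  then show ?case
  proof cases
    case 1
    then show ?thesis
      by (auto intro: horton.intros)
  next
    case 2
    then have "{..<n} = {0}"
      by auto
    then show ?thesis
      by (auto intro: horton.intros)
  next
    case 3
    define A where "A = (\<lambda>i::nat. 2 * i + 0) ` {..<(n + 1) div 2}"
    define B where "B = (\<lambda>i::nat. 2 * i + 1) ` {..<n div 2}"
    have "i \<in> A \<union> B" if "i < n" for i
    proof (cases "even i")
      case True
      then show ?thesis
        using that unfolding A_def by (auto elim!: evenE)
    next
      case False
      then show ?thesis
        using that unfolding B_def by (auto elim!: oddE)
    qed
    moreover have "i < n" if "i \<in> A \<union> B" for i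
      using that unfolding A_def B_def by auto
    ultimately have un: "A \<union> B = {..<n}"
      by blast
    have even: "even i" if "i \<in> A" for i
      using that unfolding A_def by auto
    have odd: "odd i" if "i \<in> B" for i
      using that unfolding B_def by auto
    obtain y0 where y0: "horton y0 {..<(n + 1) div 2}"
    proof -
      have "(n + 1) div 2 < n"
        using 3 by linarith
      then show ?thesis
        using less.IH that by blast
    qed
    obtain y1 where y1: "horton y1 {..<n div 2}"
      using less.IH[of "n div 2"] 3 by auto
    define z where "z e i = (if even i then e * y0 (i div 2) else 1 + e * y1 (i div 2))"
      for e :: real and i :: nat
    have lim_z: "((\<lambda>e. z e i) \<longlongrightarrow> (if even i then 0 else 1)) (at_right 0)" for i
      unfolding z_def by (auto intro!: tendsto_eq_intros)
    have lim: "((\<lambda>e. orient (z e) i j k) \<longlongrightarrow> orient (\<lambda>i. if even i then 0 else 1) i j k)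
        (at_right 0)" for i j k
      unfolding orient_def by (intro tendsto_intros lim_z)
    have fin: "finite A" "finite B"
      unfolding A_def B_def by auto
    have up: "\<forall>\<^sub>F e in at_right 0. i < j \<longrightarrow> orient (z e) i j k > 0"
      if "i \<in> A" "j \<in> A" "k \<in> B" for i j k
    proof (cases "i < j")
      case True
      have "orient (\<lambda>i. if even i then 0 else 1) i j k > 0"
        using True even[OF that(1)] even[OF that(2)] odd[OF that(3)] by (simp add: orient_def)
      then show ?thesis
        using order_tendstoD(1)[OF lim[of i j k]] True by auto
    qed auto
    have down: "\<forall>\<^sub>F e in at_right 0. i < j \<longrightarrow> orient (z e) i j k < 0"
      if "i \<in> B" "j \<in> B" "k \<in> A" for i j k
    proof (cases "i < j")
      case True
      have "orient (\<lambda>i. if even i then 0 else 1) i j k < 0"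
        using True odd[OF that(1)] odd[OF that(2)] even[OF that(3)] by (simp add: orient_def)
      then show ?thesis
        using order_tendstoD(2)[OF lim[of i j k]] True by auto
    qed auto
    have "\<forall>\<^sub>F e in at_right 0. deep_below (z e) A B"
      unfolding deep_below_def using fin up down
      by (intro eventually_conj eventually_ball_finite ballI) auto
    moreover have "\<forall>\<^sub>F e in at_right (0::real). 0 < e"
      by (rule eventually_at_right_less)
    ultimately have "\<forall>\<^sub>F e in at_right 0. deep_below (z e) A B \<and> 0 < e"
      by (rule eventually_conj)
    then obtain e where e: "deep_below (z e) A B" "0 < e"
      using eventually_happens[of _ "at_right (0::real)"] by auto
    have "horton (z e) A"
      unfolding A_def by (rule horton_dilate[OF y0 e(2), of _ _ 0]) (auto simp: z_def)
    moreover have "horton (z e) B"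
      unfolding B_def by (rule horton_dilate[OF y1 e(2), of _ _ 1]) (auto simp: z_def)
    moreover have "separates B A"
      unfolding separates_def
    proof (intro ballI impI)
      fix i j
      assume "i \<in> A" "j \<in> A" "i < j"
      then have "Suc i \<in> B \<and> i < Suc i \<and> Suc i < j"
        unfolding A_def B_def by auto
      then show "\<exists>k\<in>B. i < k \<and> k < j"
        by blast
    qed
    moreover have "separates A B"
      unfolding separates_def
    proof (intro ballI impI)
      fix i j
      assume ij: "i \<in> B" "j \<in> B" "i < j"
      then have "i < Suc i" "Suc i < j" "even (Suc i)"
        unfolding B_def by auto
      moreover from this have "Suc i \<in> A"
        using un odd ij by (metis UnE UnI2 lessThan_iff less_trans)
      ultimately have "Suc i \<in> A \<and> i < Suc i \<and> Suc i < j"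
        by blast
      then show "\<exists>k\<in>A. i < k \<and> k < j"
        by blast
    qed
    ultimately have "horton (z e) (A \<union> B)"
      using e(1) by (intro horton.split)
    then show ?thesis
      unfolding un by blast
  qed
qed

section \<open>Cones over convex sets\<close>

lemma proj_scaleR:
  assumes "u \<noteq> 0" "c \<noteq> 0"
  shows "proj (c *\<^sub>R u) = proj u"
  using assms proj_eq_iff[of u "c *\<^sub>R u"] by auto

text \<open>Of the two segments that join distinct points \<open>proj w1\<close> and \<open>proj w2\<close>, the one from \<open>w1\<close> to \<open>- w2\<close> meets the
  avoided line, so the one in \<open>X\<close> is the one from \<open>w1\<close> to \<open>w2\<close>, which contains \<open>proj (w1 + w2)\<close>.
  Together with positive scaling, this makes the positive cone over \<open>X\<close> convex.\<close>

lemma proj_cone_add: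
  assumes "semiconvex X"
    and avoid: "\<And>v. v \<noteq> 0 \<Longrightarrow> proj v \<in> X \<Longrightarrow> a \<bullet> v \<noteq> 0"
    and w1: "0 < a \<bullet> w1" "proj w1 \<in> X" and w2: "0 < a \<bullet> w2" "proj w2 \<in> X"
  shows "proj (w1 + w2) \<in> X"
proof -
  have nz: "w1 \<noteq> 0" "w2 \<noteq> 0" "w1 + w2 \<noteq> 0"
    using w1(1) w2(1) by (auto simp: add_eq_0_iff)
  obtain u v where uv: "u \<noteq> 0" "v \<noteq> 0" "proj w1 = proj u" "proj w2 = proj v"
    and sub: "proj ` (closed_segment u v - {0}) \<subseteq> X"
    using assms(1) w1(2) w2(2) unfolding semiconvex_def proj_segment_def by metis
  obtain c where c: "c \<noteq> 0" "u = c *\<^sub>R w1"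
    using proj_eq_iff[of w1 u] nz uv by auto
  obtain d where d: "d \<noteq> 0" "v = d *\<^sub>R w2"
    using proj_eq_iff[of w2 v] nz uv by auto
  show ?thesis
  proof (cases "c * d > 0")
    case True
    have cd: "c + d \<noteq> 0" "0 \<le> c / (c + d)" "c / (c + d) \<le> 1"
      using True by (auto simp: zero_less_mult_iff divide_simps)
    \<comment> \<open>the parameter at which \<open>u\<close> and \<open>v\<close> contribute equal multiples of \<open>w1\<close> and \<open>w2\<close>\<close>
    have "(1 - c / (c + d)) *\<^sub>R u + (c / (c + d)) *\<^sub>R v = (c * d / (c + d)) *\<^sub>R (w1 + w2)"
    proof -
      have "1 - c / (c + d) = d / (c + d)"
        using cd(1) by (simp add: field_simps)
      then show ?thesis
        unfolding c(2) d(2) by (simp add: scaleR_add_right mult.commute)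
    qed
    then have "(c * d / (c + d)) *\<^sub>R (w1 + w2) \<in> closed_segment u v"
      unfolding closed_segment_def using cd by force
    moreover have "(c * d / (c + d)) *\<^sub>R (w1 + w2) \<noteq> 0"
      using nz cd True by auto
    ultimately have "proj ((c * d / (c + d)) *\<^sub>R (w1 + w2)) \<in> X"
      using sub by blast
    then show ?thesis
      using proj_scaleR[OF nz(3)] True cd by (metis divide_eq_0_iff less_irrefl)
  next
    case False
    then have neg: "c * d < 0"
      using c d by (simp add: not_less order_less_le)
    define al where "al = c * (a \<bullet> w1)"
    define be where "be = d * (a \<bullet> w2)"
    have "al * be < 0"
      using neg w1(1) w2(1) unfolding al_def be_def
      by (metis (no_types, opaque_lifting) mult.assoc mult.left_commute mult_neg_pos mult_pos_pos)
    then have ab: "al - be \<noteq> 0" "0 \<le> al / (al - be)" "al / (al - be) \<le> 1"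
      by (auto simp: mult_less_0_iff divide_simps)
    \<comment> \<open>The point where the segment crosses the avoided plane. It can only be 0, the one point that
      a segment leaves out, and then \<open>w1\<close> and \<open>w2\<close> represent the same point.\<close>
    define x where "x = (1 - al / (al - be)) *\<^sub>R u + (al / (al - be)) *\<^sub>R v"
    have x: "x \<in> closed_segment u v"
      unfolding closed_segment_def x_def using ab by blast
    have "a \<bullet> x = (1 - al / (al - be)) * al + (al / (al - be)) * be"
      unfolding x_def al_def be_def c(2) d(2) by (simp add: inner_add_right)
    also have "\<dots> = 0"
      using ab(1) by (simp add: field_simps)
    finally have "a \<bullet> x = 0" .
    then have "x = 0"
      using x sub avoid by blast
    then have "(al / (al - be)) *\<^sub>R v = - ((1 - al / (al - be)) *\<^sub>R u)"
      unfolding x_def by (simp add: add_eq_0_iff)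
    moreover have "al / (al - be) \<noteq> 0"
      using \<open>al * be < 0\<close> ab by auto
    ultimately have "\<exists>t. w2 = t *\<^sub>R w1"
      unfolding c(2) d(2) using d(1)
      by (metis (no_types, opaque_lifting) mult_eq_0_iff scaleR_scaleR scaleR_minus_left
          vector_fraction_eq_iff)
    then obtain t where t: "w2 = t *\<^sub>R w1" ..
    then have "w1 + w2 = (1 + t) *\<^sub>R w1"
      by (simp add: algebra_simps)
    then show ?thesis
      using nz w1(2) proj_scaleR[OF nz(1), of "1 + t"] by auto
  qed
qed

text \<open>The sign conditions define an open set \<open>C\<close> of vectors, and by Cramer's rule
  \<open>d *\<^sub>R v\<close>, with \<open>d\<close> the determinant of \<open>x, y, z\<close>, is for each \<open>v\<close> in \<open>C\<close> a sum of multiples of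
  \<open>x, y, z\<close> that lie in the positive cone over \<open>X\<close>. Therefore \<open>proj ` C\<close> is an open subset of \<open>X\<close>.
  In particular \<open>d\<close> cannot vanish, because 0 is not in that cone.\<close>

lemma triangle_in_interior:
  fixes a x y z v :: "real ^ 3"
  assumes "semiconvex X"
    and avoid: "\<And>v. v \<noteq> 0 \<Longrightarrow> proj v \<in> X \<Longrightarrow> a \<bullet> v \<noteq> 0"
    and nz: "x \<noteq> 0" "y \<noteq> 0" "z \<noteq> 0"
    and X: "proj x \<in> X" "proj y \<in> X" "proj z \<in> X"
    and pos: "0 < (a \<bullet> x) * (v \<bullet> (cross3 y z))" "0 < (a \<bullet> y) * (v \<bullet> (cross3 z x))"
      "0 < (a \<bullet> z) * (v \<bullet> (cross3 x y))"
  shows "proj v \<in> interior X"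
proof -
  define C where "C = {v. 0 < (a \<bullet> x) * (v \<bullet> (cross3 y z)) \<and> 0 < (a \<bullet> y) * (v \<bullet> (cross3 z x)) \<and>
      0 < (a \<bullet> z) * (v \<bullet> (cross3 x y))}"
  have C0: "v \<noteq> 0" if "v \<in> C" for v
    using that unfolding C_def by auto
  have C_scale: "c *\<^sub>R v \<in> C" if "v \<in> C" "0 < c" for c v
  proof -
    have "r * (c *\<^sub>R v \<bullet> w) = c * (r * (v \<bullet> w))" for r w
      by simp
    then show ?thesis
      using that unfolding C_def by (simp only: mem_Collect_eq mult_pos_pos)
  qed
  have openC: "open C"
    unfolding C_def by (intro open_Collect_conj open_Collect_less continuous_intros)
  have "{v. v \<noteq> 0 \<and> proj v \<in> proj ` C} = C \<union> uminus ` C"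
  proof (intro equalityI subsetI)
    fix v
    assume "v \<in> {v. v \<noteq> 0 \<and> proj v \<in> proj ` C}"
    then obtain u where u: "v \<noteq> 0" "u \<in> C" "proj v = proj u"
      by auto
    then obtain c where c: "c \<noteq> 0" "v = c *\<^sub>R u"
      using proj_eq_iff[of u v] C0 by metis
    show "v \<in> C \<union> uminus ` C"
    proof (cases "c > 0")
      case True
      then show ?thesis
        using C_scale[OF u(2), of c] c by simp
    next
      case False
      then have "- v \<in> C"
        using C_scale[OF u(2), of "- c"] c by simp
      then show ?thesis
        by (metis UnI2 image_eqI minus_minus)
    qed
  next
    fix v
    assume v: "v \<in> C \<union> uminus ` C"
    then have "v \<noteq> 0"
      using C0 by auto
    moreover have "v \<in> C \<or> - v \<in> C"
      using v by auto
    moreover have "proj (- v) = proj v"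
      using proj_scaleR[OF \<open>v \<noteq> 0\<close>, of "-1"] by simp
    ultimately show "v \<in> {v. v \<noteq> 0 \<and> proj v \<in> proj ` C}"
      by (metis (mono_tags, lifting) image_eqI mem_Collect_eq)
  qed
  then have "open (proj ` C)"
    unfolding open_rp2_def using openC by (auto intro: open_negations)
  moreover have "proj ` C \<subseteq> X"
  proof safe
    fix v
    assume v: "v \<in> C"
    define d where "d = x \<bullet> (cross3 y z)"
    have "d *\<^sub>R v = (v \<bullet> (cross3 y z)) *\<^sub>R x + (v \<bullet> (cross3 z x)) *\<^sub>R y + (v \<bullet> (cross3 x y)) *\<^sub>R z"
      unfolding d_def by (simp add: cross3_simps vec_eq_iff forall_3)
    moreover have part: "0 < a \<bullet> (r *\<^sub>R w) \<and> proj (r *\<^sub>R w) \<in> X"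
      if "w \<noteq> 0" "proj w \<in> X" "0 < (a \<bullet> w) * r" for r w
      using that proj_scaleR[of w r] by (cases "r = 0") (auto simp: mult.commute)
    note parts = part[OF nz(1) X(1), of "v \<bullet> (cross3 y z)"] part[OF nz(2) X(2), of "v \<bullet> (cross3 z x)"]
      part[OF nz(3) X(3), of "v \<bullet> (cross3 x y)"]
    ultimately have "proj (d *\<^sub>R v) \<in> X" "0 < a \<bullet> (d *\<^sub>R v)"
      using v unfolding C_def
      by (auto intro!: proj_cone_add[OF assms(1) avoid] simp: inner_add_right)
    then show "proj v \<in> X"
      using proj_scaleR[OF C0[OF v], of d] by (cases "d = 0") auto
  qed
  moreover have "v \<in> C"
    using pos unfolding C_def by simp
  ultimately show ?thesis
    by (meson imageI interior_maximal subsetD)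
qed

section \<open>The points of a Horton set in the projective plane\<close>

definition lift :: "(nat \<Rightarrow> real) \<Rightarrow> nat \<Rightarrow> real ^ 3" where
  "lift y i = vector [1, real i, y i]"

lemma lift_nonzero: "lift y i \<noteq> 0"
  by (auto simp: lift_def vec_eq_iff forall_3)

lemma lift_triple: "lift y i \<bullet> cross3 (lift y j) (lift y k) = orient y i j k"
  by (simp add: lift_def orient_def cross3_simps inner_vec_def sum_3)

lemma proj_lift_inj: "inj (\<lambda>i. proj (lift y i))"
proof (rule injI)
  fix i j
  assume "proj (lift y i) = proj (lift y j)"
  then obtain c where c: "lift y j = c *\<^sub>R lift y i"
    using proj_eq_iff[OF lift_nonzero lift_nonzero] by blast
  then have "lift y j $ 1 = c * lift y i $ 1" "lift y j $ 2 = c * lift y i $ 2"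
    by simp_all
  then show "i = j"
    by (simp add: lift_def)
qed

text \<open>Three points on the line with normal vector \<open>a\<close> have vanishing determinant, because the
  determinant times \<open>a\<close> is a combination of cross products with the products \<open>a \<bullet> v\<^sub>i\<close> as
  coefficients.\<close>

lemma general_position_lift:
  assumes "\<And>i j k. i \<in> S \<Longrightarrow> j \<in> S \<Longrightarrow> k \<in> S \<Longrightarrow> i < j \<Longrightarrow> j < k \<Longrightarrow> orient y i j k \<noteq> 0"
  shows "general_position ((\<lambda>i. proj (lift y i)) ` S)"
  unfolding general_position_def
proof (intro notI, elim exE conjE)
  fix T L
  assume T: "T \<subseteq> (\<lambda>i. proj (lift y i)) ` S" "card T = 3" and L: "proj_line L" "T \<subseteq> L"
  obtain I where I: "I \<subseteq> S" "T = (\<lambda>i. proj (lift y i)) ` I"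
    using T(1) by (meson subset_imageE)
  then have "card I = 3"
    using T(2) card_image[OF inj_on_subset[OF proj_lift_inj[of y] subset_UNIV[of I]]] by simp
  then obtain p q r where pqr: "I = {p, q, r}" "p \<noteq> q" "p \<noteq> r" "q \<noteq> r"
    by (auto simp: card_3_iff)
  obtain a where a: "a \<noteq> 0" "L = {proj v | v. v \<noteq> 0 \<and> a \<bullet> v = 0}"
    using L(1) unfolding proj_line_def by blast
  have on: "a \<bullet> lift y i = 0" if "i \<in> I" for i
  proof -
    have "proj (lift y i) \<in> L"
      using that I(2) L(2) by blast
    then obtain v where v: "v \<noteq> 0" "a \<bullet> v = 0" "proj (lift y i) = proj v"
      unfolding a(2) by blast
    then obtain c where "lift y i = c *\<^sub>R v"
      using proj_eq_iff[OF v(1) lift_nonzero] by metis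
    then show ?thesis
      using v(2) by simp
  qed
  have flat: "orient y i j k = 0" if "i \<in> I" "j \<in> I" "k \<in> I" for i j k
  proof -
    let ?u = "lift y i" and ?v = "lift y j" and ?w = "lift y k"
    have "(?u \<bullet> cross3 ?v ?w) *\<^sub>R a =
        (a \<bullet> ?u) *\<^sub>R cross3 ?v ?w + (a \<bullet> ?v) *\<^sub>R cross3 ?w ?u + (a \<bullet> ?w) *\<^sub>R cross3 ?u ?v"
      by (simp add: cross3_simps vec_eq_iff forall_3)
    then have "orient y i j k *\<^sub>R a = 0"
      using on that by (simp add: lift_triple)
    then show ?thesis
      using a(1) by simp
  qed
  obtain i j k where "i \<in> I" "j \<in> I" "k \<in> I" "i < j" "j < k"
    using pqr by (cases p q rule: linorder_cases; cases p r rule: linorder_cases;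
        cases q r rule: linorder_cases) blast+
  then show False
    using assms flat I(1) by blast
qed

text \<open>The signs come from the normal vector \<open>a\<close> of a line that \<open>X\<close> avoids.\<close>

lemma empty_triangles_of_hole:
  assumes "proj_convex X" and G: "\<And>i. i \<in> G \<Longrightarrow> proj (lift y i) \<in> X"
    and S: "\<And>i. i \<in> S \<Longrightarrow> proj (lift y i) \<notin> interior X"
  shows "\<exists>s. (\<forall>i\<in>G. s i \<noteq> 0) \<and> empty_triangles y s S G"
proof -
  obtain a where a: "a \<noteq> 0" "X \<subseteq> - {proj v | v. v \<noteq> 0 \<and> a \<bullet> v = 0}" and semi: "semiconvex X"
    using assms(1) unfolding proj_convex_def euclidean_plane_def proj_line_def by blast
  have avoid: "a \<bullet> v \<noteq> 0" if "v \<noteq> 0" "proj v \<in> X" for v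
    using a(2) that by blast
  let ?s = "\<lambda>i. a \<bullet> lift y i"
  have "\<not> in_cone y ?s i j l k" if "i \<in> G" "j \<in> G" "l \<in> G" "k \<in> S" for i j l k
  proof
    assume cone: "in_cone y ?s i j l k"
    have rot: "orient y i k l = orient y k l i" "orient y i j k = orient y k i j"
      by (metis orient_rotate)+
    note tri = triangle_in_interior[OF semi avoid lift_nonzero lift_nonzero lift_nonzero
        G[OF that(1)] G[OF that(2)] G[OF that(3)]]
    have "proj (lift y k) \<in> interior X \<or> proj (- lift y k) \<in> interior X"
      using cone tri[of "lift y k"] tri[of "- lift y k"]
      unfolding in_cone_def rot inner_minus_left lift_triple by auto
    moreover have "proj (- lift y k) = proj (lift y k)"
      using proj_scaleR[OF lift_nonzero, of "-1" y k] by simp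
    ultimately show False
      using S[OF that(4)] by simp
  qed
  then have "empty_triangles y ?s S G"
    unfolding empty_triangles_def by blast
  moreover have "\<forall>i\<in>G. ?s i \<noteq> 0"
    using avoid[OF lift_nonzero] G by blast
  ultimately show ?thesis
    by (intro exI[of _ ?s]) simp
qed

theorem theorem2:
  fixes n :: nat
  shows "\<exists>P :: rp2 set. finite P \<and> card P = n \<and> general_position P \<and> \<not> (\<exists>X. proj_hole 8 P X)"
proof -
  obtain y where y: "horton y {..<n}"
    using horton_exists by blast
  define f where "f i = proj (lift y i)" for i
  have inj: "inj_on f T" for T
    using proj_lift_inj[of y] unfolding f_def by (rule inj_on_subset) simp
  have "card (f ` {..<n}) = n"
    by (simp add: card_image inj)
  moreover have "general_position (f ` {..<n})"
    unfolding f_def using horton_orient_nonzero[OF y] by (rule general_position_lift)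
  moreover have "\<not> proj_hole 8 (f ` {..<n}) X" for X
  proof
    assume hole: "proj_hole 8 (f ` {..<n}) X"
    then obtain G' where G': "G' \<subseteq> f ` {..<n}" "card G' = 8" "proj_convex X" "G' \<subseteq> X"
      unfolding proj_hole_def proj_gon_def proj_convex_hull_def by blast
    obtain G where G: "G \<subseteq> {..<n}" "G' = f ` G"
      using G'(1) by (meson subset_imageE)
    have "card G = 8"
      using G'(2) G(2) by (simp add: card_image inj)
    have "\<exists>s. (\<forall>i\<in>G. s i \<noteq> 0) \<and> empty_triangles y s {..<n} G"
      using G'(4) G(2) hole unfolding proj_hole_def f_def
      by (intro empty_triangles_of_hole[OF G'(3)]) auto
    then have "card G \<le> 7"
      using horton_empty_triangles_le_7[OF y G(1)] finite_subset[OF G(1)] by auto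
    then show False
      using \<open>card G = 8\<close> by simp
  qed
  ultimately show ?thesis
    by blast
qed

end
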